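(* Let $\lambda=(\lambda_1\ge\cdots\ge\lambda_{\ell(\lambda)}>0)$ be a partition, let $n \geq \lambda_1 + \ell(\lambda)$ be an integer, and let $\mathbf{a}=(a_1,\ldots,a_n) \in (\mathbb{Z}_{> 0})^n$. The limiting polytope $\mathcal{F}_{(\lambda, \mathbf{a})}^{\lim}$ is integrally equivalent to the product of scaled simplices $a_1\Delta_{\lambda_1}\times \cdots \times a_{\ell(\lambda)}\Delta_{\lambda_{\ell(\lambda)}}$. Consequently, it has normalized volume $$\operatorname{vol} \mathcal{F}_{(\lambda, \mathbf{a})}^{\lim} = \left( \sum_{i =1}^{\ell(\lambda)} \lambda_i\right)! \, \prod_{i=1}^{\ell(\lambda)} \frac{ a_i^{\lambda_i}}{\lambda_i !}.$$
   Context: A partition $\lambda$ is a weakly decreasing finite sequence of positive integers; $\ell(\lambda)$ is its number of parts; $[m]=\{1,\dots,m\}$. Flow polytope: for a graph $G$ on vertex set $[m+1]$ with each edge written $(i,j)$, $i<j$ (directed from $i$ to $j$), and $\mathbf{a}=(a_1,\ldots,a_m)\in\mathbb{Z}^m$, set $a_{m+1}:=-\sum_{i=1}^m a_i$. An $\mathbf{a}$-flow on $G$ is a function $f:E(G)\to\mathbb{R}_{\ge 0}$ with $\sum_{(g,i)\in E(G)} f(g,i)+a_i=\sum_{(i,j)\in E(G)} f(i,j)$ for all $1\le i\le m+1$. The flow polytope $\mathcal{F}_G(\mathbf{a})\subset\mathbb{R}^{E(G)}$ is the set of all $\mathbf{a}$-flows on $G$. The graph $G(\lambda,m)$: for an integer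 $m$ with $m-i\ge\lambda_i$ for all $i\in[\ell(\lambda)]$, $G(\lambda,m)$ is the graph on $[m+1]$ with edge set $\{(i,m+1): i\in[m]\}\cup\{(i,j): i\in[\ell(\lambda)],\ m+1-\lambda_i\le j\le m\}$. The limiting polytope is $\mathcal{F}_{(\lambda,\mathbf{a})}^{\lim}:=\mathcal{F}_{G(\lambda,\ell(\lambda)+\lambda_1)}(\mathbf{a})$, where the netflow uses the first $\ell(\lambda)+\lambda_1$ entries of $\mathbf{a}$. $\Delta_d=\{x\in\mathbb{R}_{\ge0}^{d+1}:\sum x_i=1\}$ is the standard $d$-dimensional simplex, and $c\Delta_d$ is its dilation by $c$. Integer polytopes $P\subset\mathbb{R}^p$ and $Q\subset\mathbb{R}^q$ are integrally equivalent if there is an affine map $\mathbb{R}^p\to\mathbb{R}^q$ mapping $P$ bijectively onto $Q$ and mapping $\mathbb{Z}^p\cap\operatorname{aff}(P)$ bijectively onto $\mathbb{Z}^q\cap\operatorname{aff}(Q)$, where $\operatorname{aff}$ denotes affine span. For a $d$-dimensional integer polytope $P\subset\mathbb{R}^p$, the normalized volume $\operatorname{vol}(P)$ is $d!$ times the leading coefficient of its Ehrhart polynomial $t\mapsto\#(tP\cap\mathbb{Z}^p)$; equivalently, it is the volume form on $\operatorname{aff}(P)$ assigning volume one to the smallest $d$-dimensional integer simplex in $\operatorname{aff}(P)$. *)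

theory Defs
  imports "HOL-Analysis.Analysis" "HOL-Analysis.Finite_Function_Topology"
    "HOL-Computational_Algebra.Polynomial"
begin

(* Points of R^I, for a finite index set I, are finitely supported functions that vanish
   outside I.  This makes every R^I a subspace of one real vector space, so that the library's
   linear, affine hull, convex hull and dim apply although I depends on other data. *)

definition coord_space :: "'a set \<Rightarrow> ('a \<Rightarrow>\<^sub>0 real) set" where
  "coord_space I = {x. Poly_Mapping.keys x \<subseteq> I}"

definition lattice_points :: "'a set \<Rightarrow> ('a \<Rightarrow>\<^sub>0 real) set" where
  "lattice_points I = {x \<in> coord_space I. \<forall>i. Poly_Mapping.lookup x i \<in> \<int>}"

definition integer_polytope :: "'a set \<Rightarrow> ('a \<Rightarrow>\<^sub>0 real) set \<Rightarrow> bool" where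
  "integer_polytope I P \<longleftrightarrow> (\<exists>V. finite V \<and> V \<subseteq> lattice_points I \<and> P = convex hull V)"

(* A linear map of R^I into R^J extends to the whole ambient space (by zero on the coordinates
   outside I), so it is no restriction to take L linear everywhere. *)
definition affine_map_between ::
  "'a set \<Rightarrow> 'b set \<Rightarrow> (('a \<Rightarrow>\<^sub>0 real) \<Rightarrow> ('b \<Rightarrow>\<^sub>0 real)) \<Rightarrow> bool" where
  "affine_map_between I J \<phi> \<longleftrightarrow>
     (\<exists>L c. linear L \<and> (\<forall>x\<in>coord_space I. \<phi> x = L x + c)) \<and>
     \<phi> ` coord_space I \<subseteq> coord_space J"

definition integrally_equivalent ::
  "'a set \<Rightarrow> ('a \<Rightarrow>\<^sub>0 real) set \<Rightarrow> 'b set \<Rightarrow> ('b \<Rightarrow>\<^sub>0 real) set \<Rightarrow> bool" where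
  "integrally_equivalent I P J Q \<longleftrightarrow>
     integer_polytope I P \<and> integer_polytope J Q \<and>
     (\<exists>\<phi>. affine_map_between I J \<phi> \<and>
          bij_betw \<phi> P Q \<and>
          bij_betw \<phi> (lattice_points I \<inter> affine hull P) (lattice_points J \<inter> affine hull Q))"

(* The dimension of the direction space of the affine span.  The library's aff_dim is restricted
   to Euclidean spaces. *)
definition affine_dimension :: "('a \<Rightarrow>\<^sub>0 real) set \<Rightarrow> nat" where
  "affine_dimension P = dim {x - y | x y. x \<in> P \<and> y \<in> P}"

definition ehrhart_polynomial :: "'a set \<Rightarrow> ('a \<Rightarrow>\<^sub>0 real) set \<Rightarrow> real poly" where
  "ehrhart_polynomial I P =
     (THE p. \<forall>t::nat. t \<ge> 1 \<longrightarrow>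
        poly p (real t) = real (card ((\<lambda>x. real t *\<^sub>R x) ` P \<inter> lattice_points I)))"

definition normalized_volume :: "'a set \<Rightarrow> ('a \<Rightarrow>\<^sub>0 real) set \<Rightarrow> real" where
  "normalized_volume I P = fact (affine_dimension P) * lead_coeff (ehrhart_polynomial I P)"

(* The simplex with d + 1 coordinates, indexed 1, ..., d + 1. *)
definition std_simplex :: "nat \<Rightarrow> (nat \<Rightarrow>\<^sub>0 real) set" where
  "std_simplex d = {x \<in> coord_space {1..d+1}.
     (\<forall>i\<in>{1..d+1}. Poly_Mapping.lookup x i \<ge> 0) \<and>
     (\<Sum>i\<in>{1..d+1}. Poly_Mapping.lookup x i) = 1}"

(* The product of the sets P s, s in S, where coordinate k of the factor s becomes coordinate
   (s, k); map_key (Pair s) x is the component of x in the factor s. *)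
definition product_polytope ::
  "'s set \<Rightarrow> ('s \<Rightarrow> ('k \<Rightarrow>\<^sub>0 real) set) \<Rightarrow> (('s \<times> 'k) \<Rightarrow>\<^sub>0 real) set" where
  "product_polytope S P = {x. fst ` Poly_Mapping.keys x \<subseteq> S \<and>
     (\<forall>s\<in>S. Poly_Mapping.map_key (Pair s) x \<in> P s)}"

definition is_partition :: "nat list \<Rightarrow> bool" where
  "is_partition lam \<longleftrightarrow> sorted_wrt (\<ge>) lam \<and> (\<forall>x\<in>set lam. x > 0)"

(* Parts are numbered from 1; beyond the last part the value is 0, so that the empty partition
   has first part 0. *)
definition nth_part :: "nat list \<Rightarrow> nat \<Rightarrow> nat" where
  "nth_part lam i = (if 1 \<le> i \<and> i \<le> length lam then lam ! (i - 1) else 0)"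

(* Entry i, numbered from 1, of (a_1, ..., a_m, - sum a). *)
definition netflow :: "int list \<Rightarrow> nat \<Rightarrow> int" where
  "netflow a i = (if i \<le> length a then a ! (i - 1) else - sum_list a)"

(* A graph on the vertex set {1..m+1} is given by its set of edges (i, j), i < j;
   m is the length of the netflow vector. *)
definition flow_polytope :: "(nat \<times> nat) set \<Rightarrow> int list \<Rightarrow> ((nat \<times> nat) \<Rightarrow>\<^sub>0 real) set" where
  "flow_polytope E a = {f \<in> coord_space E.
     (\<forall>e\<in>E. Poly_Mapping.lookup f e \<ge> 0) \<and>
     (\<forall>i\<in>{1..length a + 1}.
        (\<Sum>g | (g, i) \<in> E. Poly_Mapping.lookup f (g, i)) + real_of_int (netflow a i)
        = (\<Sum>j | (i, j) \<in> E. Poly_Mapping.lookup f (i, j)))}"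

definition partition_graph :: "nat list \<Rightarrow> nat \<Rightarrow> (nat \<times> nat) set" where
  "partition_graph lam m =
     {(i, m + 1) | i. i \<in> {1..m}} \<union>
     {(i, j) | i j. i \<in> {1..length lam} \<and> m + 1 - nth_part lam i \<le> j \<and> j \<le> m}"

definition limiting_graph :: "nat list \<Rightarrow> (nat \<times> nat) set" where
  "limiting_graph lam = partition_graph lam (length lam + nth_part lam 1)"

definition limiting_polytope :: "nat list \<Rightarrow> int list \<Rightarrow> ((nat \<times> nat) \<Rightarrow>\<^sub>0 real) set" where
  "limiting_polytope lam a =
     flow_polytope (limiting_graph lam) (take (length lam + nth_part lam 1) a)"

end

theory Submission
  imports Defs
begin

text \<open>The vertices up to the number of parts have no incoming edges, so the flow out of such a
vertex \<open>i\<close> is an arbitrary point of a scaled simplex. Every other vertex except the sink has the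
edge to the sink as its only outgoing edge, whose flow is therefore determined by the rest, and
conservation at the sink is automatic. Forgetting the determined edges is a linear map whose inverse
on the polytope is affine and integral. The volume follows by counting: the number of lattice points
of the \<open>t\<close>-th dilate is the product over \<open>i\<close> of the binomial coefficients
\<open>(t * a i + d i) choose d i\<close>, where \<open>d i\<close> is the \<open>i\<close>-th part; this is a polynomial in \<open>t\<close> whose leading
coefficient is the product of the \<open>a i ^ d i / fact (d i)\<close>.\<close>

subsection \<open>Integral equivalence by a lattice section\<close>

text \<open>Scalar multiplication is defined by abstracting a function, so \<open>lookup\<close> can
  be evaluated only once that function has finite support; here the support lies inside
  \<open>keys x\<close>.\<close>

lemma lookup_scaleR [simp]:
  fixes x :: "'a \<Rightarrow>\<^sub>0 'b::real_vector"
  shows "Poly_Mapping.lookup (r *\<^sub>R x) i = r *\<^sub>R Poly_Mapping.lookup x i"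
proof -
  have "{i. r *\<^sub>R Poly_Mapping.lookup x i \<noteq> 0} \<subseteq> Poly_Mapping.keys x"
    by (auto simp: in_keys_iff)
  then have "finite {i. r *\<^sub>R Poly_Mapping.lookup x i \<noteq> 0}"
    using finite_keys finite_subset by blast
  then show ?thesis
    by (simp add: scaleR_poly_mapping_def)
qed

lemma coord_space_iff: "x \<in> coord_space I \<longleftrightarrow> (\<forall>i. i \<notin> I \<longrightarrow> Poly_Mapping.lookup x i = 0)"
  by (auto simp: coord_space_def in_keys_iff)

lemma subspace_coord_space: "subspace (coord_space I)"
  by (auto simp: subspace_def coord_space_iff lookup_add)

lemma lattice_points_iff:
  "x \<in> lattice_points I \<longleftrightarrow> x \<in> coord_space I \<and> (\<forall>i. Poly_Mapping.lookup x i \<in> \<int>)"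
  by (simp add: lattice_points_def)

lemma lattice_points_add:
  "x \<in> lattice_points I \<Longrightarrow> y \<in> lattice_points I \<Longrightarrow> x + y \<in> lattice_points I"
  by (auto simp: lattice_points_iff coord_space_iff lookup_add)

lemma lattice_points_scaleR:
  "r \<in> \<int> \<Longrightarrow> x \<in> lattice_points I \<Longrightarrow> r *\<^sub>R x \<in> lattice_points I"
  by (auto simp: lattice_points_iff coord_space_iff)

lemma lattice_points_sum:
  "(\<And>k. k \<in> K \<Longrightarrow> f k \<in> lattice_points I) \<Longrightarrow> sum f K \<in> lattice_points I"
  by (auto simp: lattice_points_iff coord_space_iff lookup_sum intro!: sum.neutral Ints_sum)

lemma lattice_points_single:
  "i \<in> I \<Longrightarrow> r \<in> \<int> \<Longrightarrow> Poly_Mapping.single i r \<in> lattice_points I"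
  by (auto simp: lattice_points_iff coord_space_iff lookup_single when_def)

text \<open>Hull minimality gives both inclusions, because the image and the preimage of an affine
  set under an affine map are affine.\<close>

lemma affine_hull_affine_image:
  assumes "linear f"
  shows "affine hull ((\<lambda>x. f x + c) ` S) = (\<lambda>x. f x + c) ` (affine hull S)"
proof
  have comb: "f (u *\<^sub>R x + v *\<^sub>R y) + c = u *\<^sub>R (f x + c) + v *\<^sub>R (f y + c)" if "u + v = 1" for u v x y
    using that assms
    by (simp add: linear_add linear_scale algebra_simps flip: scaleR_add_left)
  show "affine hull ((\<lambda>x. f x + c) ` S) \<subseteq> (\<lambda>x. f x + c) ` (affine hull S)"
  proof (rule hull_minimal)
    show "(\<lambda>x. f x + c) ` S \<subseteq> (\<lambda>x. f x + c) ` (affine hull S)"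
      by (intro image_mono hull_subset)
    show "affine ((\<lambda>x. f x + c) ` (affine hull S))"
      by (rule affine_def[THEN iffD2])
        (auto simp flip: comb intro!: imageI mem_affine[OF affine_affine_hull])
  qed
  have "affine hull S \<subseteq> (\<lambda>x. f x + c) -` (affine hull ((\<lambda>x. f x + c) ` S))"
  proof (rule hull_minimal)
    show "S \<subseteq> (\<lambda>x. f x + c) -` (affine hull ((\<lambda>x. f x + c) ` S))"
      using hull_subset by fastforce
    show "affine ((\<lambda>x. f x + c) -` (affine hull ((\<lambda>x. f x + c) ` S)))"
      by (rule affine_def[THEN iffD2])
        (auto simp: comb intro!: mem_affine[OF affine_affine_hull])
  qed
  then show "(\<lambda>x. f x + c) ` (affine hull S) \<subseteq> affine hull ((\<lambda>x. f x + c) ` S)"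
    by blast
qed

lemma convex_hull_affine_image:
  assumes "linear f"
  shows "convex hull ((\<lambda>x. f x + c) ` S) = (\<lambda>x. f x + c) ` (convex hull S)"
proof -
  have "(\<lambda>x. f x + c) ` T = (+) c ` f ` T" for T
    by (auto simp: image_image add.commute)
  then show ?thesis
    by (simp add: convex_hull_translation convex_hull_linear_image[OF assms])
qed

lemma dim_linear_image_eq:
  assumes "linear f" "inj_on f (span S)"
  shows "dim (f ` S) = dim S"
proof -
  obtain B where B: "B \<subseteq> S" "independent B" "S \<subseteq> span B" "card B = dim S"
    using real_vector.basis_exists by blast
  have inj: "inj_on f (span B)"
    using assms(2) real_vector.span_mono[OF B(1)] inj_on_subset by blast
  have "span (f ` B) = span (f ` S)"
    using B by (metis assms(1) real_vector.linear_span_image real_vector.span_eq real_vector.span_superset subset_trans)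
  moreover have "independent (f ` B)"
    using real_vector.linear_independent_injective_image[OF assms(1) B(2) inj] .
  moreover have "card (f ` B) = card B"
    by (intro card_image inj_on_subset[OF inj real_vector.span_superset])
  ultimately show ?thesis
    using real_vector.dim_eq_card B(4) by metis
qed

text \<open>The affine map \<open>y \<mapsto> M y + c\<close> is a section of \<open>F\<close>, and both respect the lattices.\<close>

locale lattice_section =
  fixes I :: "'a set" and J :: "'b set"
    and F :: "('a \<Rightarrow>\<^sub>0 real) \<Rightarrow> ('b \<Rightarrow>\<^sub>0 real)"
    and M :: "('b \<Rightarrow>\<^sub>0 real) \<Rightarrow> ('a \<Rightarrow>\<^sub>0 real)"
    and c :: "'a \<Rightarrow>\<^sub>0 real"
  assumes linear_F: "linear F" and linear_M: "linear M"
    and F_coord: "x \<in> coord_space I \<Longrightarrow> F x \<in> coord_space J"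
    and F_lattice: "x \<in> lattice_points I \<Longrightarrow> F x \<in> lattice_points J"
    and M_lattice: "y \<in> lattice_points J \<Longrightarrow> M y \<in> lattice_points I"
    and c_lattice: "c \<in> lattice_points I"
    and F_c: "F c = 0"
    and F_M: "y \<in> coord_space J \<Longrightarrow> F (M y) = y"
begin

lemma F_section: "y \<in> coord_space J \<Longrightarrow> F (M y + c) = y"
  by (simp add: linear_add[OF linear_F] F_c F_M)

text \<open>The witness is \<open>F\<close>, with the section as its inverse. The section law holds
  on \<open>coord_space J\<close>, which contains the affine hull of \<open>Q\<close> because a
  subspace is affine, so the same pair of maps serves both required bijections.\<close>

lemma integrally_equivalent_section:
  assumes "integer_polytope J Q"
  shows "integrally_equivalent I ((\<lambda>y. M y + c) ` Q) J Q"
proof -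
  obtain V where V: "finite V" "V \<subseteq> lattice_points J" "Q = convex hull V"
    using assms by (auto simp: integer_polytope_def)
  have "Q \<subseteq> coord_space J"
    unfolding V(3) using V(2)
    by (intro hull_minimal subspace_imp_convex subspace_coord_space) (auto simp: lattice_points_iff)
  then have aff: "affine hull Q \<subseteq> coord_space J"
    by (intro hull_minimal subspace_imp_affine subspace_coord_space)
  have inv: "F (M y + c) = y" if "y \<in> affine hull Q" for y
    using F_section aff that by blast
  have "integer_polytope I ((\<lambda>y. M y + c) ` Q)"
    unfolding integer_polytope_def
    using V by (intro exI[of _ "(\<lambda>y. M y + c) ` V"])
      (auto simp: convex_hull_affine_image[OF linear_M]
        intro!: lattice_points_add c_lattice M_lattice)
  moreover have "affine_map_between I J F"
    unfolding affine_map_between_def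
    using linear_F F_coord by (auto intro!: exI[of _ F] exI[of _ 0])
  moreover have "bij_betw F ((\<lambda>y. M y + c) ` Q) Q"
    using inv hull_subset[of Q affine]
    by (intro bij_betw_byWitness[where f' = "\<lambda>y. M y + c"]) (auto simp: subset_iff)
  moreover have "bij_betw F (lattice_points I \<inter> affine hull ((\<lambda>y. M y + c) ` Q))
      (lattice_points J \<inter> affine hull Q)"
    unfolding affine_hull_affine_image[OF linear_M]
    by (intro bij_betw_byWitness[where f' = "\<lambda>y. M y + c"])
      (auto simp: inv intro!: lattice_points_add c_lattice M_lattice dest: F_lattice)
  ultimately show ?thesis
    using assms unfolding integrally_equivalent_def by blast
qed

lemma card_dilation_section:
  fixes t :: nat
  assumes "Q \<subseteq> coord_space J"
  shows "card ((\<lambda>x. real t *\<^sub>R x) ` (\<lambda>y. M y + c) ` Q \<inter> lattice_points I)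
       = card ((\<lambda>x. real t *\<^sub>R x) ` Q \<inter> lattice_points J)"
proof (rule bij_betw_same_card)
  \<comment> \<open>The section for the \<open>t\<close>-th dilates: the offset \<open>c\<close> is
    scaled along with \<open>t\<close>, and stays a lattice vector because \<open>t\<close> is an
    integer.\<close>
  let ?g = "\<lambda>z. M z + real t *\<^sub>R c"
  have F1: "F (real t *\<^sub>R (M y + c)) = real t *\<^sub>R y" if "y \<in> Q" for y
    using that assms by (simp add: linear_scale[OF linear_F] F_section subsetD)
  have g: "?g (real t *\<^sub>R y) = real t *\<^sub>R (M y + c)" for y
    by (simp add: linear_scale[OF linear_M] scaleR_add_right)
  show "bij_betw F ((\<lambda>x. real t *\<^sub>R x) ` (\<lambda>y. M y + c) ` Q \<inter> lattice_points I)
      ((\<lambda>x. real t *\<^sub>R x) ` Q \<inter> lattice_points J)"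
  proof (rule bij_betw_byWitness[where f' = ?g])
    show "F ` ((\<lambda>x. real t *\<^sub>R x) ` (\<lambda>y. M y + c) ` Q \<inter> lattice_points I)
        \<subseteq> (\<lambda>x. real t *\<^sub>R x) ` Q \<inter> lattice_points J"
      using F1 F_lattice by (auto simp: image_iff)
    show "?g ` ((\<lambda>x. real t *\<^sub>R x) ` Q \<inter> lattice_points J)
        \<subseteq> (\<lambda>x. real t *\<^sub>R x) ` (\<lambda>y. M y + c) ` Q \<inter> lattice_points I"
    proof safe
      fix y assume y: "y \<in> Q" "real t *\<^sub>R y \<in> lattice_points J"
      show "?g (real t *\<^sub>R y) \<in> (\<lambda>x. real t *\<^sub>R x) ` (\<lambda>y. M y + c) ` Q"
        unfolding g using y by blast
      show "?g (real t *\<^sub>R y) \<in> lattice_points I"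
        using lattice_points_add[OF M_lattice[OF y(2)] lattice_points_scaleR[OF _ c_lattice]]
        by simp
    qed
  qed (auto simp: F1 g)
qed

text \<open>The offset \<open>c\<close> cancels in differences, so the direction vectors are mapped
  by \<open>M\<close> alone, and \<open>F\<close> inverts \<open>M\<close> on their span.\<close>

lemma affine_dimension_section:
  assumes "Q \<subseteq> coord_space J"
  shows "affine_dimension ((\<lambda>y. M y + c) ` Q) = affine_dimension Q"
proof -
  let ?D = "{x - y | x y. x \<in> Q \<and> y \<in> Q}"
  have "{x - y | x y. x \<in> (\<lambda>y. M y + c) ` Q \<and> y \<in> (\<lambda>y. M y + c) ` Q} = M ` ?D"
  proof -
    have "{x - y | x y. x \<in> (\<lambda>y. M y + c) ` Q \<and> y \<in> (\<lambda>y. M y + c) ` Q}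
        = {M x + c - (M y + c) | x y. x \<in> Q \<and> y \<in> Q}"
      by blast
    also have "\<dots> = {M (x - y) | x y. x \<in> Q \<and> y \<in> Q}"
      by (simp add: linear_diff[OF linear_M])
    also have "\<dots> = M ` ?D"
      by blast
    finally show ?thesis .
  qed
  moreover have "span ?D \<subseteq> coord_space J"
    using assms subspace_diff[OF subspace_coord_space]
    by (intro real_vector.span_minimal subspace_coord_space) blast
  then have "inj_on M (span ?D)"
    using F_M by (intro inj_on_inverseI[where g = F]) blast
  ultimately show ?thesis
    by (simp add: affine_dimension_def dim_linear_image_eq[OF linear_M])
qed

text \<open>The volume depends on a polytope only through its dimension and the lattice point counts
  of its dilates. Both agree, so the two \<open>THE\<close> descriptions coincide before any Ehrhart
  polynomial is known.\<close>

lemma normalized_volume_section: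
  assumes "Q \<subseteq> coord_space J"
  shows "normalized_volume I ((\<lambda>y. M y + c) ` Q) = normalized_volume J Q"
  unfolding normalized_volume_def ehrhart_polynomial_def
    affine_dimension_section[OF assms] card_dilation_section[OF assms] ..

end

text \<open>Two candidates agree at every positive integer, so their difference has infinitely many
  roots and is zero.\<close>

lemma ehrhart_polynomial_eqI:
  assumes "\<And>t::nat. t \<ge> 1 \<Longrightarrow>
    poly p (real t) = real (card ((\<lambda>x. real t *\<^sub>R x) ` P \<inter> lattice_points I))"
  shows "ehrhart_polynomial I P = p"
  unfolding ehrhart_polynomial_def
proof (rule the_equality)
  fix q :: "real poly"
  assume q: "\<forall>t::nat. t \<ge> 1 \<longrightarrow>
    poly q (real t) = real (card ((\<lambda>x. real t *\<^sub>R x) ` P \<inter> lattice_points I))"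
  have "real ` {1..} \<subseteq> {x. poly (q - p) x = 0}"
    using q assms by auto
  moreover have "infinite (real ` {1..})"
    by (simp add: finite_image_iff infinite_Ici)
  ultimately have "infinite {x. poly (q - p) x = 0}"
    using finite_subset by blast
  then show "q = p"
    using poly_roots_finite[of "q - p"] by auto
qed (simp add: assms)

subsection \<open>Products of scaled simplices\<close>

abbreviation (input) blocks :: "'s set \<Rightarrow> ('s \<Rightarrow> nat) \<Rightarrow> ('s \<times> nat) set" where
  "blocks S d \<equiv> (SIGMA s:S. {1..d s + 1})"

text \<open>The product of the simplices scaled by \<open>c s\<close>, given by inequalities, so
  that dilation merely rescales \<open>c\<close>. Requiring nonnegativity at every \<open>p\<close>
  adds nothing, since coordinates outside the blocks vanish.\<close>

definition simplex_product ::
  "'s set \<Rightarrow> ('s \<Rightarrow> nat) \<Rightarrow> ('s \<Rightarrow> real) \<Rightarrow> (('s \<times> nat) \<Rightarrow>\<^sub>0 real) set" where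
  "simplex_product S d c = {x \<in> coord_space (blocks S d).
     (\<forall>p. Poly_Mapping.lookup x p \<ge> 0) \<and>
     (\<forall>s\<in>S. (\<Sum>k\<in>{1..d s + 1}. Poly_Mapping.lookup x (s, k)) = c s)}"

lemma simplex_product_coord: "simplex_product S d c \<subseteq> coord_space (blocks S d)"
  by (auto simp: simplex_product_def)

lemma scaleR_std_simplex_iff:
  assumes "c > 0"
  shows "x \<in> (\<lambda>x. c *\<^sub>R x) ` std_simplex d \<longleftrightarrow>
    x \<in> coord_space {1..d+1} \<and> (\<forall>k\<in>{1..d+1}. Poly_Mapping.lookup x k \<ge> 0) \<and>
    (\<Sum>k\<in>{1..d+1}. Poly_Mapping.lookup x k) = c" (is "?L \<longleftrightarrow> ?R")
proof
  assume ?L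
  then show ?R
    using assms by (auto simp: std_simplex_def coord_space_iff simp del: sum.cl_ivl_Suc simp flip: sum_distrib_left)
next
  assume ?R
  then have "(1/c) *\<^sub>R x \<in> std_simplex d"
    using assms by (auto simp: std_simplex_def coord_space_iff simp del: sum.cl_ivl_Suc simp flip: sum_divide_distrib)
  moreover have "x = c *\<^sub>R ((1/c) *\<^sub>R x)"
    using assms by simp
  ultimately show ?L
    by blast
qed

text \<open>Since \<open>Pair s\<close> is injective, \<open>map_key (Pair s)\<close> reads off the
  coordinates \<open>(s, k)\<close>; both sides then unfold to the same conditions on these
  numbers.\<close>

lemma product_polytope_scaled_simplices:
  fixes S :: "'s set"
  assumes "\<And>s. s \<in> S \<Longrightarrow> c s > 0"
  shows "product_polytope S (\<lambda>s. (\<lambda>x. c s *\<^sub>R x) ` std_simplex (d s)) = simplex_product S d c"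
proof -
  have lookup: "Poly_Mapping.lookup (Poly_Mapping.map_key (Pair s) x) k = Poly_Mapping.lookup x (s, k)"
    for s :: 's and x :: "('s \<times> nat) \<Rightarrow>\<^sub>0 real" and k
    by (simp add: map_key.rep_eq inj_def)
  have keys: "fst ` Poly_Mapping.keys x \<subseteq> S \<longleftrightarrow> (\<forall>s k. s \<notin> S \<longrightarrow> Poly_Mapping.lookup x (s, k) = 0)"
    for x :: "('s \<times> nat) \<Rightarrow>\<^sub>0 real"
    by (force simp: in_keys_iff)
  have "x \<in> product_polytope S (\<lambda>s. (\<lambda>x. c s *\<^sub>R x) ` std_simplex (d s)) \<longleftrightarrow>
      (\<forall>s k. s \<notin> S \<longrightarrow> Poly_Mapping.lookup x (s, k) = 0) \<and>
      (\<forall>s\<in>S. (\<forall>k. k \<notin> {1..d s + 1} \<longrightarrow> Poly_Mapping.lookup x (s, k) = 0) \<and>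
        (\<forall>k\<in>{1..d s + 1}. Poly_Mapping.lookup x (s, k) \<ge> 0) \<and>
        (\<Sum>k\<in>{1..d s + 1}. Poly_Mapping.lookup x (s, k)) = c s)" for x
    using assms
    by (auto simp add: product_polytope_def scaleR_std_simplex_iff lookup keys
        coord_space_iff[where I = "{_.._}"] simp del: sum.cl_ivl_Suc)
  moreover have "x \<in> simplex_product S d c \<longleftrightarrow>
      (\<forall>s k. s \<notin> S \<longrightarrow> Poly_Mapping.lookup x (s, k) = 0) \<and>
      (\<forall>s\<in>S. (\<forall>k. k \<notin> {1..d s + 1} \<longrightarrow> Poly_Mapping.lookup x (s, k) = 0) \<and>
        (\<forall>k\<in>{1..d s + 1}. Poly_Mapping.lookup x (s, k) \<ge> 0) \<and>
        (\<Sum>k\<in>{1..d s + 1}. Poly_Mapping.lookup x (s, k)) = c s)" for x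
    by (auto simp: simplex_product_def coord_space_iff simp del: sum.cl_ivl_Suc atLeastAtMost_iff)
      (metis order_refl)
  ultimately show ?thesis
    by blast
qed

lemma scaleR_simplex_product:
  assumes "t > 0"
  shows "(\<lambda>x. t *\<^sub>R x) ` simplex_product S d c = simplex_product S d (\<lambda>s. t * c s)"
proof
  show "(\<lambda>x. t *\<^sub>R x) ` simplex_product S d c \<subseteq> simplex_product S d (\<lambda>s. t * c s)"
    using assms by (auto simp: simplex_product_def coord_space_iff simp del: sum.cl_ivl_Suc simp flip: sum_distrib_left)
  show "simplex_product S d (\<lambda>s. t * c s) \<subseteq> (\<lambda>x. t *\<^sub>R x) ` simplex_product S d c"
  proof
    fix x assume "x \<in> simplex_product S d (\<lambda>s. t * c s)"
    then have "(1/t) *\<^sub>R x \<in> simplex_product S d c"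
      using assms by (auto simp: simplex_product_def coord_space_iff simp del: sum.cl_ivl_Suc simp flip: sum_divide_distrib)
    moreover have "x = t *\<^sub>R ((1/t) *\<^sub>R x)"
      using assms by simp
    ultimately show "x \<in> (\<lambda>x. t *\<^sub>R x) ` simplex_product S d c"
      by blast
  qed
qed

section \<open>Vertices and the convex hull description of the product\<close>

text \<open>A vertex of a product is a choice of one vertex in every factor; \<open>g s\<close> is
  the position of the only nonzero coordinate in factor \<open>s\<close>.\<close>

definition simplex_vertex :: "'s set \<Rightarrow> ('s \<Rightarrow> real) \<Rightarrow> ('s \<Rightarrow> nat) \<Rightarrow> ('s \<times> nat) \<Rightarrow>\<^sub>0 real" where
  "simplex_vertex S c g = (\<Sum>s\<in>S. c s *\<^sub>R Poly_Mapping.single (s, g s) 1)"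

lemma lookup_simplex_vertex:
  assumes "finite S"
  shows "Poly_Mapping.lookup (simplex_vertex S c g) (s, k) = (if s \<in> S \<and> g s = k then c s else 0)"
proof -
  have "Poly_Mapping.lookup (simplex_vertex S c g) (s, k)
      = (\<Sum>r\<in>S. if r = s then (if g s = k then c s else 0) else 0)"
    unfolding simplex_vertex_def lookup_sum
    by (intro sum.cong) (auto simp: lookup_single when_def)
  then show ?thesis
    using assms by simp
qed

lemma simplex_vertex_in_simplex_product:
  assumes "finite S" "\<And>s. s \<in> S \<Longrightarrow> c s \<ge> 0" "\<And>s. s \<in> S \<Longrightarrow> g s \<in> {1..d s + 1}"
  shows "simplex_vertex S c g \<in> simplex_product S d c"
  using assms by (auto simp: simplex_product_def coord_space_iff lookup_simplex_vertex simp del: sum.cl_ivl_Suc)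

lemma convex_simplex_product: "convex (simplex_product S d c)"
  unfolding convex_def
proof (intro ballI allI impI)
  fix x y and u v :: real
  assume "x \<in> simplex_product S d c" "y \<in> simplex_product S d c" "0 \<le> u" "0 \<le> v" "u + v = 1"
  then show "u *\<^sub>R x + v *\<^sub>R y \<in> simplex_product S d c"
    by (auto simp add: simplex_product_def coord_space_iff lookup_add sum.distrib
        simp del: sum.cl_ivl_Suc simp flip: sum_distrib_left distrib_right)
qed

text \<open>Dividing the block \<open>s\<close> of a point by \<open>c s\<close> gives a probability
  distribution on \<open>{1..d s + 1}\<close>. The product distribution supplies convex weights on
  the vertices, and its marginals recover the coordinates of the point.\<close>

lemma simplex_product_eq_convex_hull:
  assumes S: "finite S" and c: "\<And>s. s \<in> S \<Longrightarrow> c s > 0"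
  shows "simplex_product S d c = convex hull (simplex_vertex S c ` (\<Pi>\<^sub>E s\<in>S. {1..d s + 1}))"
proof
  show "convex hull (simplex_vertex S c ` (\<Pi>\<^sub>E s\<in>S. {1..d s + 1})) \<subseteq> simplex_product S d c"
    using S c
    by (intro hull_minimal convex_simplex_product)
      (force intro!: simplex_vertex_in_simplex_product dest: PiE_mem less_imp_le)
  show "simplex_product S d c \<subseteq> convex hull (simplex_vertex S c ` (\<Pi>\<^sub>E s\<in>S. {1..d s + 1}))"
  proof
    fix x assume x: "x \<in> simplex_product S d c"
    define G where "G = (\<Pi>\<^sub>E s\<in>S. {1..d s + 1})"
    define q where "q s k = Poly_Mapping.lookup x (s, k) / c s" for s k
    \<comment> \<open>the probability of the vertex \<open>g\<close> when its entries \<open>g s\<close> are drawn independently from \<open>q s\<close>\<close>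
    define w where "w g = (\<Prod>s\<in>S. q s (g s))" for g
    have G: "finite G"
      unfolding G_def using S by (simp add: finite_PiE)
    have q_sum: "(\<Sum>k\<in>{1..d s + 1}. q s k) = 1" if "s \<in> S" for s
      using x c that by (force simp: q_def simplex_product_def simp del: sum.cl_ivl_Suc simp flip: sum_divide_distrib)
    have w_nonneg: "w g \<ge> 0" for g
      using x c by (auto simp: w_def q_def simplex_product_def intro!: prod_nonneg divide_nonneg_pos)
    have w_sum: "sum w G = 1"
    proof -
      have "sum w G = (\<Prod>s\<in>S. \<Sum>k\<in>{1..d s + 1}. q s k)"
        unfolding w_def G_def using S by (subst prod_sum_PiE) auto
      then show ?thesis
        using q_sum by simp
    qed
    have marginal: "(\<Sum>g\<in>G. if g s = k then w g else 0) = q s k" if "s \<in> S" "k \<in> {1..d s + 1}" for s k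
    proof -
      \<comment> \<open>The event \<open>g s = k\<close> is absorbed into the factor
        \<open>s\<close> by setting its other values to zero, so the restricted sum is again a
        product of sums.\<close>
      define h where "h r j = (if r = s \<and> j \<noteq> k then 0 else q r j)" for r j
      have h_sum: "(\<Sum>j\<in>{1..d r + 1}. h r j) = (if r = s then q s k else 1)" if "r \<in> S" for r
      proof (cases "r = s")
        case True
        then have "(\<Sum>j\<in>{1..d r + 1}. h r j) = (\<Sum>j\<in>{1..d s + 1}. if j = k then q s k else 0)"
          unfolding h_def by (intro sum.cong) auto
        then show ?thesis
          using True \<open>k \<in> _\<close> by (simp del: sum.cl_ivl_Suc)
      next
        case False
        then show ?thesis
          using q_sum[OF that] by (simp add: h_def del: sum.cl_ivl_Suc)
      qed
      have "(if g s = k then w g else 0) = (\<Prod>r\<in>S. h r (g r))" for g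
      proof (cases "g s = k")
        case True
        then show ?thesis
          by (auto simp: w_def h_def intro!: prod.cong)
      next
        case False
        then have "h s (g s) = 0"
          by (simp add: h_def)
        then show ?thesis
          using False S \<open>s \<in> S\<close> by (simp add: prod_zero_iff) blast
      qed
      then have "(\<Sum>g\<in>G. if g s = k then w g else 0) = (\<Prod>r\<in>S. \<Sum>j\<in>{1..d r + 1}. h r j)"
        unfolding G_def using S by (subst prod_sum_PiE) auto
      also have "\<dots> = q s k"
        using S \<open>s \<in> S\<close> h_sum by simp
      finally show ?thesis .
    qed
    have "(\<Sum>g\<in>G. w g *\<^sub>R simplex_vertex S c g) = x"
    proof (rule poly_mapping_eqI)
      fix p :: "'a \<times> nat"
      obtain s k where p: "p = (s, k)"
        by fastforce
      show "Poly_Mapping.lookup (\<Sum>g\<in>G. w g *\<^sub>R simplex_vertex S c g) p = Poly_Mapping.lookup x p"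
      proof (cases "p \<in> blocks S d")
        case True
        then have "Poly_Mapping.lookup (\<Sum>g\<in>G. w g *\<^sub>R simplex_vertex S c g) p
            = c s * (\<Sum>g\<in>G. if g s = k then w g else 0)"
          by (auto simp: p lookup_sum lookup_simplex_vertex[OF S] sum_distrib_left intro!: sum.cong)
        then show ?thesis
          using True marginal[of s k] c[of s] by (auto simp: p q_def)
      next
        case False
        then have "Poly_Mapping.lookup x p = 0"
          using x by (auto simp: p simplex_product_def coord_space_iff)
        moreover have "Poly_Mapping.lookup (simplex_vertex S c g) p = 0" if "g \<in> G" for g
          using False that by (force simp: G_def p lookup_simplex_vertex[OF S] dest: PiE_mem)
        ultimately show ?thesis
          by (simp add: lookup_sum)
      qed
    qed
    moreover have "(\<Sum>g\<in>G. w g *\<^sub>R simplex_vertex S c g) \<in> convex hull (simplex_vertex S c ` G)"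
      using w_nonneg w_sum
      by (intro convex_sum[OF G convex_convex_hull]) (auto intro: hull_inc)
    ultimately show "x \<in> convex hull (simplex_vertex S c ` (\<Pi>\<^sub>E s\<in>S. {1..d s + 1}))"
      by (simp add: G_def)
  qed
qed

lemma integer_polytope_simplex_product:
  assumes "finite S" "\<And>s. s \<in> S \<Longrightarrow> c s > 0" "\<And>s. s \<in> S \<Longrightarrow> c s \<in> \<int>"
  shows "integer_polytope (blocks S d) (simplex_product S d c)"
  unfolding integer_polytope_def
proof (intro exI conjI)
  show "finite (simplex_vertex S c ` (\<Pi>\<^sub>E s\<in>S. {1..d s + 1}))"
    using assms(1) by (simp add: finite_PiE)
  show "simplex_vertex S c ` (\<Pi>\<^sub>E s\<in>S. {1..d s + 1}) \<subseteq> lattice_points (blocks S d)"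
    using assms(3)
    by (force simp: simplex_vertex_def dest: PiE_mem
      intro!: lattice_points_sum lattice_points_scaleR lattice_points_single)
  show "simplex_product S d c = convex hull (simplex_vertex S c ` (\<Pi>\<^sub>E s\<in>S. {1..d s + 1}))"
    by (rule simplex_product_eq_convex_hull) (use assms in auto)
qed

section \<open>Dimension of the product\<close>

text \<open>In each factor the differences between the unit vector at \<open>k > 1\<close> and the
  one at \<open>1\<close> form a basis of the direction space; there are \<open>d s\<close> of
  them.\<close>

lemma affine_dimension_simplex_product:
  assumes S: "finite S" and c: "\<And>s. s \<in> S \<Longrightarrow> c s > 0"
  shows "affine_dimension (simplex_product S d c) = (\<Sum>s\<in>S. d s)"
proof -
  define K where "K = (SIGMA s:S. {2..d s + 1})"
  define b :: "'a \<times> nat \<Rightarrow> ('a \<times> nat) \<Rightarrow>\<^sub>0 real"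
    where "b p = Poly_Mapping.single p 1 - Poly_Mapping.single (fst p, 1) 1" for p
  define D where "D = {x - y | x y. x \<in> simplex_product S d c \<and> y \<in> simplex_product S d c}"
  have K: "finite K"
    unfolding K_def using S by auto
  \<comment> \<open>On the coordinates in \<open>K\<close> the vectors \<open>b p\<close> look like
    unit vectors. This yields injectivity of \<open>b\<close>, independence, and the coefficients of
    any combination.\<close>
  have lookup_b: "Poly_Mapping.lookup (b p) r = (if p = r then 1 else 0)" if "p \<in> K" "r \<in> K" for p r
    using that by (auto simp: b_def K_def lookup_minus lookup_single when_def)
  have inj: "inj_on b K"
    using lookup_b by (metis inj_onI zero_neq_one)
  have coeff: "Poly_Mapping.lookup (\<Sum>p\<in>K. u p *\<^sub>R b p) r = u r" if "r \<in> K" for u r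
  proof -
    have "Poly_Mapping.lookup (\<Sum>p\<in>K. u p *\<^sub>R b p) r = (\<Sum>p\<in>K. if p = r then u r else 0)"
      using that by (auto simp: lookup_sum lookup_b intro!: sum.cong)
    then show ?thesis
      using K that by simp
  qed
  have "independent (b ` K)"
  proof (rule real_vector.independent_if_scalars_zero)
    show "finite (b ` K)"
      using K by simp
    fix u x assume "(\<Sum>v\<in>b ` K. u v *\<^sub>R v) = 0" "x \<in> b ` K"
    then show "u x = 0"
      using coeff[of _ "u \<circ> b"] by (auto simp: sum.reindex[OF inj] o_def)
  qed
  moreover have "D \<subseteq> span (b ` K)"
  proof
    fix z assume "z \<in> D"
    then have z: "z \<in> coord_space (blocks S d)"
      and z_sum: "\<And>s. s \<in> S \<Longrightarrow> (\<Sum>k\<in>{1..d s + 1}. Poly_Mapping.lookup z (s, k)) = 0"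
      by (auto simp: D_def simplex_product_def coord_space_iff lookup_minus sum_subtractf simp del: sum.cl_ivl_Suc)
    \<comment> \<open>Coefficients are forced at the coordinates in \<open>K\<close>; the remaining
      coordinate \<open>(s, 1)\<close> matches because each block of \<open>z\<close> sums to
      zero.\<close>
    have "z = (\<Sum>p\<in>K. Poly_Mapping.lookup z p *\<^sub>R b p)" (is "z = ?w")
    proof (rule poly_mapping_eqI)
      fix p :: "'a \<times> nat"
      obtain s k where p: "p = (s, k)"
        by fastforce
      consider "p \<in> K" | "s \<in> S" "k = 1" | "p \<notin> blocks S d"
        by (force simp: p K_def)
      then show "Poly_Mapping.lookup z p = Poly_Mapping.lookup ?w p"
      proof cases
        case 1
        then show ?thesis
          by (simp add: coeff)
      next
        case 2
        have "Poly_Mapping.lookup ?w p = (\<Sum>r\<in>S. \<Sum>j\<in>{2..d r + 1}. if r = s then - Poly_Mapping.lookup z (s, j) else 0)"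
          unfolding K_def using S
          by (subst sum.Sigma) (auto simp: p 2 lookup_sum b_def lookup_minus lookup_single when_def intro!: sum.cong)
        also have "\<dots> = (\<Sum>r\<in>S. if r = s then - (\<Sum>j\<in>{2..d s + 1}. Poly_Mapping.lookup z (s, j)) else 0)"
          by (auto intro!: sum.cong simp: sum_negf simp del: sum.cl_ivl_Suc)
        also have "\<dots> = - (\<Sum>j\<in>{2..d s + 1}. Poly_Mapping.lookup z (s, j))"
          using S 2 by (simp del: sum.cl_ivl_Suc)
        also have "\<dots> = Poly_Mapping.lookup z p"
          using z_sum[OF 2(1)] sum.atLeast_Suc_atMost[of 1 "d s + 1" "\<lambda>k. Poly_Mapping.lookup z (s, k)"]
          by (simp add: p 2 numeral_2_eq_2 del: sum.cl_ivl_Suc)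
        finally show ?thesis ..
      next
        case 3
        then have "Poly_Mapping.lookup (b r) p = 0" if "r \<in> K" for r
          using that by (force simp: b_def K_def p lookup_minus lookup_single when_def)
        then show ?thesis
          using 3 z by (auto simp: p coord_space_iff lookup_sum)
      qed
    qed
    then show "z \<in> span (b ` K)"
      by (metis (no_types, lifting) imageI real_vector.span_base real_vector.span_scale real_vector.span_sum)
  qed
  moreover have "b ` K \<subseteq> span D"
  proof safe
    fix s k assume sk: "(s, k) \<in> K"
    \<comment> \<open>These two vertices differ only in factor \<open>s\<close>, so their difference
      is \<open>c s\<close> times \<open>b (s, k)\<close>.\<close>
    let ?v = "simplex_vertex S c ((\<lambda>_. 1)(s := k))" and ?v' = "simplex_vertex S c (\<lambda>_. 1)"
    have "?v \<in> simplex_product S d c" "?v' \<in> simplex_product S d c"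
      using sk S c by (auto simp: K_def less_imp_le intro!: simplex_vertex_in_simplex_product)
    then have "?v - ?v' \<in> D"
      by (auto simp: D_def)
    then have "(1 / c s) *\<^sub>R (?v - ?v') \<in> span D"
      by (intro real_vector.span_scale real_vector.span_base)
    moreover have "(1 / c s) *\<^sub>R (?v - ?v') = b (s, k)"
      using sk c[of s]
      by (intro poly_mapping_eqI)
        (auto simp: K_def b_def lookup_minus lookup_single when_def lookup_simplex_vertex[OF S] split: if_splits)
    ultimately show "b (s, k) \<in> span D"
      by simp
  qed
  ultimately have "dim D = card (b ` K)"
    by (intro real_vector.dim_eq_card) (auto simp: real_vector.span_eq)
  also have "\<dots> = (\<Sum>s\<in>S. d s)"
    using S by (simp add: card_image[OF inj]) (simp add: K_def)
  finally show ?thesis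
    by (simp add: affine_dimension_def D_def)
qed

section \<open>Lattice points of dilates and the normalized volume\<close>

text \<open>A lattice point amounts to an independent choice, for each \<open>s\<close>, of a list
  of \<open>d s + 1\<close> natural numbers with sum \<open>N s\<close>, and stars and bars counts
  these lists.\<close>

lemma card_simplex_product_lattice:
  fixes N :: "'s \<Rightarrow> nat"
  assumes S: "finite S"
  shows "card (simplex_product S d (\<lambda>s. real (N s)) \<inter> lattice_points (blocks S d))
       = (\<Prod>s\<in>S. (N s + d s) choose d s)"
proof -
  define T where "T s = {l :: nat list. length l = d s + 1 \<and> sum_list l = N s}" for s
  define G :: "('s \<Rightarrow> nat list) \<Rightarrow> ('s \<times> nat) \<Rightarrow>\<^sub>0 real"
    where "G g = (\<Sum>(s, k)\<in>blocks S d. Poly_Mapping.single (s, k) (real (g s ! (k - 1))))" for g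
  \<comment> \<open>Coordinate \<open>k\<close> becomes list entry \<open>k - 1\<close>. The floor
    is exact on the points in question, and \<open>restrict\<close> gives the default value off
    \<open>S\<close> that \<open>PiE\<close> demands.\<close>
  define H :: "(('s \<times> nat) \<Rightarrow>\<^sub>0 real) \<Rightarrow> 's \<Rightarrow> nat list"
    where "H x = restrict (\<lambda>s. map (\<lambda>k. nat \<lfloor>Poly_Mapping.lookup x (s, Suc k)\<rfloor>) [0..<d s + 1]) S" for x
  have lookup_G: "Poly_Mapping.lookup (G g) p
      = (if p \<in> blocks S d then real (g (fst p) ! (snd p - 1)) else 0)" for g p
  proof -
    have "Poly_Mapping.lookup (G g) p
        = (\<Sum>q\<in>blocks S d. if q = p then real (g (fst p) ! (snd p - 1)) else 0)"
      unfolding G_def lookup_sum by (intro sum.cong) (auto simp: lookup_single when_def)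
    then show ?thesis
      using S by (simp add: finite_SigmaI)
  qed
  have shift: "(\<Sum>k\<in>{1..d s + 1}. f k) = (\<Sum>k<d s + 1. f (Suc k))" for f :: "nat \<Rightarrow> 'b::comm_monoid_add" and s
    using sum.atLeast1_atMost_eq[of f "d s + 1"] by simp
  have nat_floor: "real (nat \<lfloor>Poly_Mapping.lookup x p\<rfloor>) = Poly_Mapping.lookup x p"
    if x: "x \<in> simplex_product S d (\<lambda>s. real (N s))" "x \<in> lattice_points (blocks S d)" for x p
  proof -
    obtain z where "Poly_Mapping.lookup x p = real_of_int z"
      using x(2) by (metis Ints_cases lattice_points_iff)
    moreover have "Poly_Mapping.lookup x p \<ge> 0"
      using x(1) by (cases p) (simp add: simplex_product_def)
    ultimately show ?thesis
      by simp
  qed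
  have "bij_betw G (\<Pi>\<^sub>E s\<in>S. T s) (simplex_product S d (\<lambda>s. real (N s)) \<inter> lattice_points (blocks S d))"
  proof (rule bij_betw_byWitness[where f' = H])
    show "\<forall>g\<in>\<Pi>\<^sub>E s\<in>S. T s. H (G g) = g"
    proof
      fix g assume g: "g \<in> (\<Pi>\<^sub>E s\<in>S. T s)"
      have "H (G g) s = g s" for s
      proof (cases "s \<in> S")
        case True
        then have "length (g s) = d s + 1"
          using g by (auto simp: T_def dest: PiE_mem)
        then show ?thesis
          using True by (intro nth_equalityI) (auto simp: H_def lookup_G simp del: upt_Suc)
      next
        case False
        then show ?thesis
          using PiE_arb[OF g] by (simp add: H_def)
      qed
      then show "H (G g) = g"
        by blast
    qed
    show "\<forall>x\<in>simplex_product S d (\<lambda>s. real (N s)) \<inter> lattice_points (blocks S d). G (H x) = x"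
    proof
      fix x assume x: "x \<in> simplex_product S d (\<lambda>s. real (N s)) \<inter> lattice_points (blocks S d)"
      have "Poly_Mapping.lookup (G (H x)) p = Poly_Mapping.lookup x p" for p
      proof (cases "p \<in> blocks S d")
        case True
        then show ?thesis
          using x by (cases p) (auto simp: lookup_G H_def nat_floor simp del: upt_Suc)
      next
        case False
        then show ?thesis
          using x by (cases p) (auto simp: lookup_G lattice_points_iff coord_space_iff)
      qed
      then show "G (H x) = x"
        by (rule poly_mapping_eqI)
    qed
    show "G ` (\<Pi>\<^sub>E s\<in>S. T s) \<subseteq> simplex_product S d (\<lambda>s. real (N s)) \<inter> lattice_points (blocks S d)"
    proof safe
      fix g assume g: "g \<in> (\<Pi>\<^sub>E s\<in>S. T s)"
      have "(\<Sum>k\<in>{1..d s + 1}. Poly_Mapping.lookup (G g) (s, k)) = real (N s)" if "s \<in> S" for s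
      proof -
        have gs: "length (g s) = d s + 1" "sum_list (g s) = N s"
          using g that by (auto simp: T_def dest: PiE_mem)
        have "(\<Sum>k\<in>{1..d s + 1}. Poly_Mapping.lookup (G g) (s, k)) = (\<Sum>k<d s + 1. real (g s ! k))"
          unfolding shift using that by (intro sum.cong) (auto simp: lookup_G)
        then show ?thesis
          using gs by (simp add: sum_list_sum_nth atLeast0LessThan del: sum.lessThan_Suc flip: of_nat_sum)
      qed
      then show "G g \<in> simplex_product S d (\<lambda>s. real (N s))"
        by (simp add: simplex_product_def coord_space_iff lookup_G del: sum.cl_ivl_Suc)
      show "G g \<in> lattice_points (blocks S d)"
        by (simp add: lattice_points_iff coord_space_iff lookup_G)
    qed
    show "H ` (simplex_product S d (\<lambda>s. real (N s)) \<inter> lattice_points (blocks S d)) \<subseteq> (\<Pi>\<^sub>E s\<in>S. T s)"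
    proof (rule image_subsetI)
      fix x assume "x \<in> simplex_product S d (\<lambda>s. real (N s)) \<inter> lattice_points (blocks S d)"
      then have x: "x \<in> simplex_product S d (\<lambda>s. real (N s))" "x \<in> lattice_points (blocks S d)"
        by auto
      have "sum_list (H x s) = N s" if "s \<in> S" for s
      proof -
        have "real (sum_list (H x s)) = (\<Sum>k<d s + 1. Poly_Mapping.lookup x (s, Suc k))"
          using that by (simp add: H_def sum_list_sum_nth nat_floor[OF x] atLeast0LessThan del: upt_Suc sum.lessThan_Suc)
        also have "\<dots> = real (N s)"
          using that x shift[of "\<lambda>k. Poly_Mapping.lookup x (s, k)" s]
          by (simp add: simplex_product_def del: sum.cl_ivl_Suc sum.lessThan_Suc)
        finally show ?thesis
          by simp
      qed
      then show "H x \<in> (\<Pi>\<^sub>E s\<in>S. T s)"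
        by (auto simp: T_def H_def simp del: upt_Suc)
    qed
  qed
  then have "card (simplex_product S d (\<lambda>s. real (N s)) \<inter> lattice_points (blocks S d)) = (\<Prod>s\<in>S. card (T s))"
    using bij_betw_same_card card_PiE[OF S] by metis
  \<comment> \<open>The list count comes as a binomial with lower index \<open>N s\<close>; symmetry
    turns this into \<open>d s\<close>.\<close>
  also have "\<dots> = (\<Prod>s\<in>S. (N s + d s) choose d s)"
    using binomial_symmetric[of "N s" "N s + d s" for s] by (simp add: T_def card_length_sum_list)
  finally show ?thesis .
qed

text \<open>This factorization into terms linear in \<open>n\<close> makes the count a polynomial in
  \<open>t\<close> when \<open>n\<close> is \<open>t * N s\<close>.\<close>

lemma binomial_eq_prod:
  "real ((n + d) choose d) = (1 / fact d) * (\<Prod>j<d. 1 + real j + real n)"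
proof -
  have "real ((n + d) choose d) = pochhammer (real n + 1) d / fact d"
    by (simp add: binomial_gbinomial gbinomial_pochhammer')
  also have "pochhammer (real n + 1) d = (\<Prod>j<d. 1 + real j + real n)"
    unfolding pochhammer_prod atLeast0LessThan by (intro prod.cong) auto
  finally show ?thesis
    by simp
qed

lemma normalized_volume_simplex_product:
  fixes N :: "'s \<Rightarrow> nat"
  assumes S: "finite S" and N: "\<And>s. s \<in> S \<Longrightarrow> N s > 0"
  shows "normalized_volume (blocks S d) (simplex_product S d (\<lambda>s. real (N s)))
       = fact (\<Sum>s\<in>S. d s) * (\<Prod>s\<in>S. real (N s) ^ d s / fact (d s))"
proof -
  define p :: "real poly"
    \<comment> \<open>The linear factor is \<open>1 + j + N s * t\<close>, with \<open>t\<close> as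
      the variable. Its leading coefficient is \<open>N s\<close> because \<open>N s\<close> is
      positive.\<close>
    where "p = (\<Prod>s\<in>S. smult (1 / fact (d s)) (\<Prod>j<d s. [:1 + real j, real (N s):]))"
  have "ehrhart_polynomial (blocks S d) (simplex_product S d (\<lambda>s. real (N s))) = p"
  proof (rule ehrhart_polynomial_eqI)
    fix t :: nat assume "t \<ge> 1"
    then have "(\<lambda>x. real t *\<^sub>R x) ` simplex_product S d (\<lambda>s. real (N s))
        = simplex_product S d (\<lambda>s. real (t * N s))"
      by (simp add: scaleR_simplex_product)
    then show "poly p (real t) = real (card ((\<lambda>x. real t *\<^sub>R x) ` simplex_product S d (\<lambda>s. real (N s))
        \<inter> lattice_points (blocks S d)))"
      by (simp only: card_simplex_product_lattice[OF S] of_nat_prod binomial_eq_prod)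
        (simp add: p_def poly_prod)
  qed
  moreover have "lead_coeff p = (\<Prod>s\<in>S. real (N s) ^ d s / fact (d s))"
    unfolding p_def lead_coeff_prod lead_coeff_smult by (intro prod.cong) (auto dest: N)
  moreover have "affine_dimension (simplex_product S d (\<lambda>s. real (N s))) = (\<Sum>s\<in>S. d s)"
    by (rule affine_dimension_simplex_product) (use S N in auto)
  ultimately show ?thesis
    by (simp add: normalized_volume_def)
qed

subsection \<open>Flows\<close>

lemma sum_netflow: "(\<Sum>i=1..length a + 1. netflow a i) = 0"
proof -
  have "(\<Sum>i=1..length a. netflow a i) = (\<Sum>i=1..length a. a ! (i - 1))"
    by (intro sum.cong) (auto simp: netflow_def)
  also have "\<dots> = sum_list a"
    using sum.atLeast1_atMost_eq[of "\<lambda>i. a ! (i - 1)" "length a"]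
    by (simp add: sum_list_sum_nth atLeast0LessThan)
  finally show ?thesis
    by (simp add: netflow_def)
qed

text \<open>Summing over all vertices, conservation at the sink follows from the other vertices.\<close>

lemma flow_polytopeI:
  assumes E: "E \<subseteq> {1..length a + 1} \<times> {1..length a + 1}"
    and f: "f \<in> coord_space E" "\<And>e. e \<in> E \<Longrightarrow> Poly_Mapping.lookup f e \<ge> 0"
    and cons: "\<And>i. i \<in> {1..length a} \<Longrightarrow>
      (\<Sum>g | (g, i) \<in> E. Poly_Mapping.lookup f (g, i)) + real_of_int (netflow a i)
      = (\<Sum>j | (i, j) \<in> E. Poly_Mapping.lookup f (i, j))"
  shows "f \<in> flow_polytope E a"
proof -
  let ?V = "{1..length a + 1}"
  define inflow where "inflow i = (\<Sum>g | (g, i) \<in> E. Poly_Mapping.lookup f (g, i))" for i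
  define outflow where "outflow i = (\<Sum>j | (i, j) \<in> E. Poly_Mapping.lookup f (i, j))" for i
  have fin: "finite {g. (g, i) \<in> E}" "finite {j. (i, j) \<in> E}" for i
    by (rule finite_subset[of _ ?V]; use E in auto)+
  \<comment> \<open>Double counting: every edge contributes once at its tail and once at its head.
    Listing edges by head produces swapped pairs, hence \<open>prod.swap\<close> below.\<close>
  have out: "sum outflow ?V = (\<Sum>e\<in>E. Poly_Mapping.lookup f e)"
  proof -
    have "(SIGMA i:?V. {j. (i, j) \<in> E}) = E"
      using E by blast
    then show ?thesis
      unfolding outflow_def by (subst sum.Sigma) (simp_all add: fin)
  qed
  have "sum inflow ?V = (\<Sum>e\<in>E. Poly_Mapping.lookup f e)"
  proof -
    have "(SIGMA i:?V. {g. (g, i) \<in> E}) = prod.swap ` E"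
      using E by (force simp: image_iff)
    moreover have "(\<Sum>(i, g)\<in>prod.swap ` E. Poly_Mapping.lookup f (g, i)) = (\<Sum>e\<in>E. Poly_Mapping.lookup f e)"
      by (subst sum.reindex) (simp_all add: case_prod_unfold)
    ultimately show ?thesis
      unfolding inflow_def by (subst sum.Sigma) (simp_all add: fin)
  qed
  moreover have "(\<Sum>i\<in>?V. real_of_int (netflow a i)) = 0"
    using sum_netflow[of a] by (simp flip: of_int_sum)
  ultimately have "(\<Sum>i\<in>?V. inflow i + real_of_int (netflow a i) - outflow i) = 0"
    using out by (simp only: sum.distrib sum_subtractf)
  moreover have "(\<Sum>i\<in>{1..length a}. inflow i + real_of_int (netflow a i) - outflow i) = 0"
    using cons by (intro sum.neutral) (simp add: inflow_def outflow_def)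
  ultimately have "inflow (length a + 1) + real_of_int (netflow a (length a + 1)) = outflow (length a + 1)"
    by simp
  moreover have "i \<in> {1..length a} \<or> i = length a + 1" if "i \<in> ?V" for i
    using that by auto
  ultimately have "\<forall>i\<in>?V. inflow i + real_of_int (netflow a i) = outflow i"
    using cons unfolding inflow_def outflow_def by blast
  then show ?thesis
    using f by (simp add: flow_polytope_def inflow_def outflow_def)
qed

section \<open>The flow polytope as the image of a product of simplices\<close>

text \<open>The bound \<open>d_le\<close> forces every edge out of a vertex in \<open>{1..L}\<close>
  to end beyond \<open>L\<close>. The graph thus has three layers: left vertices
  \<open>{1..L}\<close>, right vertices \<open>{L+1..m}\<close> and the sink
  \<open>m + 1\<close>.\<close>

locale bipartite_flow =
  fixes L m :: nat and d :: "nat \<Rightarrow> nat" and a :: "int list"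
  assumes d_le: "i \<in> {1..L} \<Longrightarrow> L + d i \<le> m"
    and length_a: "length a = m"
    and a_pos: "x \<in> set a \<Longrightarrow> x > 0"
begin

definition E :: "(nat \<times> nat) set" where
  "E = {(i, m + 1) | i. i \<in> {1..m}} \<union>
     {(i, j) | i j. i \<in> {1..L} \<and> m + 1 - d i \<le> j \<and> j \<le> m}"

abbreviation (input) "B \<equiv> blocks {1..L} d"

text \<open>Coordinate \<open>(i, k)\<close> of the product corresponds to the edge \<open>(i, m + 2 - k)\<close>; unless that edge ends in
the sink, its flow is passed on along the edge to the sink.\<close>

definition edge_vector :: "nat \<times> nat \<Rightarrow> (nat \<times> nat) \<Rightarrow>\<^sub>0 real" where
  "edge_vector = (\<lambda>(i, k). Poly_Mapping.single (i, m + 2 - k) 1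
     + (if k = 1 then 0 else Poly_Mapping.single (m + 2 - k, m + 1) 1))"

text \<open>Forgets the edges from the right vertices to the sink and keeps those leaving the left
  vertices; \<open>k = 1\<close> is the direct edge to the sink.\<close>

definition F :: "((nat \<times> nat) \<Rightarrow>\<^sub>0 real) \<Rightarrow> (nat \<times> nat) \<Rightarrow>\<^sub>0 real" where
  "F x = (\<Sum>(i, k)\<in>B. Poly_Mapping.lookup x (i, m + 2 - k) *\<^sub>R Poly_Mapping.single (i, k) 1)"

definition M :: "((nat \<times> nat) \<Rightarrow>\<^sub>0 real) \<Rightarrow> (nat \<times> nat) \<Rightarrow>\<^sub>0 real" where
  "M y = (\<Sum>p\<in>B. Poly_Mapping.lookup y p *\<^sub>R edge_vector p)"

text \<open>The inhomogeneous part of the section: each right vertex sends its own netflow straight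
  to the sink.\<close>

definition base_flow :: "(nat \<times> nat) \<Rightarrow>\<^sub>0 real" where
  "base_flow = (\<Sum>j\<in>{L+1..m}. real_of_int (netflow a j) *\<^sub>R Poly_Mapping.single (j, m + 1) 1)"

lemma netflow_pos: "i \<in> {1..m} \<Longrightarrow> netflow a i > 0"
  by (auto simp: netflow_def length_a intro!: a_pos nth_mem)

lemma d_le_m: "i \<in> {1..L} \<Longrightarrow> d i \<le> m"
  using d_le[of i] by simp

lemma edge_from_left_iff:
  assumes "i \<in> {1..L}"
  shows "(i, j) \<in> E \<longleftrightarrow> m + 1 - d i \<le> j \<and> j \<le> m + 1"
  using assms d_le[OF assms] by (auto simp: E_def)

lemma edge_from_right_iff:
  assumes "i \<in> {L+1..m}"
  shows "(i, j) \<in> E \<longleftrightarrow> j = m + 1"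
  using assms by (auto simp: E_def)

lemma edge_into_left: "i \<in> {1..L} \<Longrightarrow> (g, i) \<notin> E"
  using d_le[of i] d_le[of g] by (auto simp: E_def)

text \<open>The additive form avoids truncated subtraction and is the condition that
  \<open>m + 2 - j\<close> is a valid index in block \<open>r\<close>.\<close>

lemma edge_into_right_iff:
  assumes "j \<in> {L+1..m}"
  shows "(r, j) \<in> E \<longleftrightarrow> r \<in> {1..L} \<and> m + 1 \<le> d r + j"
  using assms by (auto simp: E_def)

text \<open>The split separates free from determined edges, so direct edges from left vertices to
  the sink belong to the first case.\<close>

lemma edge_cases:
  assumes "e \<in> E"
  obtains (left) i j where "e = (i, j)" "i \<in> {1..L}" "m + 1 - d i \<le> j" "j \<le> m + 1"
  | (right) j where "e = (j, m + 1)" "j \<in> {L+1..m}"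
proof -
  obtain i j where ij: "e = (i, j)"
    by fastforce
  with assms have "i \<in> {1..L} \<or> i \<in> {L+1..m} \<and> j = m + 1"
    by (auto simp: E_def)
  then show thesis
    using assms ij edge_from_left_iff[of i j] left right by blast
qed

lemma E_subset: "E \<subseteq> {1..length a + 1} \<times> {1..length a + 1}"
  using d_le_m d_le unfolding length_a by (fastforce elim: edge_cases)

text \<open>The reflection \<open>j \<mapsto> m + 2 - j\<close> exchanges the heads of edges leaving
  \<open>i\<close> with the indices of block \<open>i\<close>.\<close>

lemma sum_out_left:
  assumes "i \<in> {1..L}"
  shows "(\<Sum>j | (i, j) \<in> E. f j) = (\<Sum>k\<in>{1..d i + 1}. f (m + 2 - k))"
  by (rule sum.reindex_bij_witness[of _ "\<lambda>k. m + 2 - k" "\<lambda>j. m + 2 - j"])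
    (use d_le_m[OF assms] in \<open>auto simp: edge_from_left_iff[OF assms]\<close>)

lemma lookup_F:
  "Poly_Mapping.lookup (F x) (i, k) = (if (i, k) \<in> B then Poly_Mapping.lookup x (i, m + 2 - k) else 0)"
proof -
  have "Poly_Mapping.lookup (F x) (i, k)
      = (\<Sum>q\<in>B. if q = (i, k) then Poly_Mapping.lookup x (i, m + 2 - k) else 0)"
    unfolding F_def lookup_sum by (intro sum.cong) (auto simp: lookup_single when_def split: if_splits)
  then show ?thesis
    by simp
qed

text \<open>Each \<open>edge_vector\<close> is a path to the sink. An edge leaving a left vertex
  occurs only as the first edge of a single path, since a second edge starts beyond
  \<open>L\<close>.\<close>

lemma lookup_M_left:
  assumes "i \<in> {1..L}" "m + 1 - d i \<le> j" "j \<le> m + 1"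
  shows "Poly_Mapping.lookup (M y) (i, j) = Poly_Mapping.lookup y (i, m + 2 - j)"
proof -
  have "Poly_Mapping.lookup (M y) (i, j)
      = (\<Sum>q\<in>B. if q = (i, m + 2 - j) then Poly_Mapping.lookup y (i, m + 2 - j) else 0)"
    unfolding M_def lookup_sum
  proof (intro sum.cong refl)
    fix q assume "q \<in> B"
    then obtain r k where q: "q = (r, k)" "r \<in> {1..L}" "1 \<le> k" "k \<le> d r + 1"
      by auto
    have "L < m + 2 - k"
      using d_le[OF q(2)] q by simp
    then have "m + 2 - k \<noteq> i" "m + 2 - k = j \<longleftrightarrow> k = m + 2 - j"
      using assms by auto
    then show "Poly_Mapping.lookup (Poly_Mapping.lookup y q *\<^sub>R edge_vector q) (i, j)
        = (if q = (i, m + 2 - j) then Poly_Mapping.lookup y (i, m + 2 - j) else 0)"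
      by (auto simp: q(1) edge_vector_def lookup_add lookup_single when_def)
  qed
  then show ?thesis
    using assms by auto
qed

text \<open>The paths using the edge from \<open>j\<close> to the sink are those passing through
  \<open>j\<close>, one for each edge into \<open>j\<close>. As \<open>j \<le> m\<close>, they have
  \<open>k \<noteq> 1\<close> and so do contain a second edge.\<close>

lemma lookup_M_right:
  assumes "j \<in> {L+1..m}"
  shows "Poly_Mapping.lookup (M y) (j, m + 1)
    = (\<Sum>r | (r, j) \<in> E. Poly_Mapping.lookup y (r, m + 2 - j))"
proof -
  have "Poly_Mapping.lookup (M y) (j, m + 1)
      = (\<Sum>q\<in>B. if snd q = m + 2 - j then Poly_Mapping.lookup y (fst q, m + 2 - j) else 0)"
    unfolding M_def lookup_sum
  proof (intro sum.cong refl)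
    fix q assume "q \<in> B"
    then obtain r k where q: "q = (r, k)" "r \<in> {1..L}" "1 \<le> k" "k \<le> d r + 1"
      by auto
    have "r \<noteq> j" "m + 2 - k = j \<longleftrightarrow> k = m + 2 - j" "k = m + 2 - j \<longrightarrow> k \<noteq> 1"
      using assms q d_le[OF q(2)] by auto
    then show "Poly_Mapping.lookup (Poly_Mapping.lookup y q *\<^sub>R edge_vector q) (j, m + 1)
        = (if snd q = m + 2 - j then Poly_Mapping.lookup y (fst q, m + 2 - j) else 0)"
      by (auto simp: q(1) edge_vector_def lookup_add lookup_single when_def)
  qed
  also have "\<dots> = (\<Sum>r\<in>{1..L}. \<Sum>k\<in>{1..d r + 1}.
      if k = m + 2 - j then Poly_Mapping.lookup y (r, m + 2 - j) else 0)"
    by (subst sum.Sigma) (auto intro!: sum.cong)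
  also have "\<dots> = (\<Sum>r\<in>{1..L}. if (r, j) \<in> E then Poly_Mapping.lookup y (r, m + 2 - j) else 0)"
    using assms by (intro sum.cong) (auto simp: edge_into_right_iff simp del: sum.cl_ivl_Suc)
  also have "\<dots> = (\<Sum>r | (r, j) \<in> E. Poly_Mapping.lookup y (r, m + 2 - j))"
    using assms by (intro sum.mono_neutral_cong_right) (auto simp: edge_into_right_iff)
  finally show ?thesis .
qed

lemma lookup_base_flow:
  "Poly_Mapping.lookup base_flow (i, j)
    = (if i \<in> {L+1..m} \<and> j = m + 1 then real_of_int (netflow a i) else 0)"
proof -
  have "Poly_Mapping.lookup base_flow (i, j)
      = (\<Sum>r\<in>{L+1..m}. if r = i then (if j = m + 1 then real_of_int (netflow a i) else 0) else 0)"
    unfolding base_flow_def lookup_sum by (intro sum.cong) (auto simp: lookup_single when_def)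
  then show ?thesis
    by auto
qed

lemma edge_vector_lattice:
  assumes "p \<in> B"
  shows "edge_vector p \<in> lattice_points E"
proof -
  obtain i k where p: "p = (i, k)" "i \<in> {1..L}" "1 \<le> k" "k \<le> d i + 1"
    using assms by auto
  have "(i, m + 2 - k) \<in> E" "k \<noteq> 1 \<longrightarrow> (m + 2 - k, m + 1) \<in> E"
    using p d_le[OF p(2)] by (auto simp: E_def)
  then show ?thesis
    by (auto simp: p(1) edge_vector_def intro!: lattice_points_add lattice_points_single)
qed

lemma M_coord: "M y \<in> coord_space E"
  unfolding M_def using edge_vector_lattice
  by (intro subspace_sum subspace_scale subspace_coord_space) (auto simp: lattice_points_iff)

sublocale lattice_section E B F M base_flow
proof (rule lattice_section.intro)
  show "linear F"
    by (intro linearI)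
      (auto simp: F_def lookup_add scaleR_sum_right case_prod_unfold scaleR_add_left simp flip: sum.distrib)
  show "linear M"
    by (intro linearI)
      (auto simp: M_def lookup_add scaleR_sum_right case_prod_unfold scaleR_add_left simp flip: sum.distrib)
  show "F x \<in> coord_space B" for x
    by (auto simp: coord_space_iff lookup_F)
  show "F x \<in> lattice_points B" if "x \<in> lattice_points E" for x
    using that by (auto simp: lattice_points_iff coord_space_iff lookup_F)
  show "M y \<in> lattice_points E" if "y \<in> lattice_points B" for y
    unfolding M_def using edge_vector_lattice that
    by (intro lattice_points_sum lattice_points_scaleR) (auto simp: lattice_points_iff)
  show "base_flow \<in> lattice_points E"
    unfolding base_flow_def
    by (intro lattice_points_sum lattice_points_scaleR lattice_points_single)
      (auto simp: edge_from_right_iff)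
  \<comment> \<open>\<open>F\<close> reads only edges with tail in \<open>{1..L}\<close>, whereas
    \<open>base_flow\<close> lives on edges with tail beyond \<open>L\<close>.\<close>
  show "F base_flow = 0"
    by (rule poly_mapping_eqI) (auto simp: lookup_F lookup_base_flow split: prod.splits)
  show "F (M y) = y" if "y \<in> coord_space B" for y
  proof (rule poly_mapping_eqI)
    fix p :: "nat \<times> nat"
    obtain i k where p: "p = (i, k)"
      by fastforce
    show "Poly_Mapping.lookup (F (M y)) p = Poly_Mapping.lookup y p"
    proof (cases "p \<in> B")
      case True
      then show ?thesis
        using d_le_m[of i] by (auto simp: p lookup_F lookup_M_left)
    next
      case False
      then show ?thesis
        using that by (auto simp: p lookup_F coord_space_iff)
    qed
  qed
qed

text \<open>Conservation at a left vertex is the defining equation of its simplex, and conservation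
  at a right vertex is the formula of the section for its edge to the sink.\<close>

lemma flow_polytope_eq:
  "flow_polytope E a = (\<lambda>y. M y + base_flow) ` simplex_product {1..L} d (\<lambda>i. real_of_int (netflow a i))"
proof (intro equalityI subsetI)
  fix x assume x: "x \<in> flow_polytope E a"
  then have x_coord: "x \<in> coord_space E" and x_nonneg: "\<And>e. e \<in> E \<Longrightarrow> Poly_Mapping.lookup x e \<ge> 0"
    and cons: "\<And>i. i \<in> {1..m} \<Longrightarrow>
      (\<Sum>g | (g, i) \<in> E. Poly_Mapping.lookup x (g, i)) + real_of_int (netflow a i)
      = (\<Sum>j | (i, j) \<in> E. Poly_Mapping.lookup x (i, j))"
    by (auto simp: flow_polytope_def length_a)
  have "F x \<in> simplex_product {1..L} d (\<lambda>i. real_of_int (netflow a i))"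
    unfolding simplex_product_def
  proof (intro CollectI conjI ballI allI)
    show "F x \<in> coord_space B"
      using x_coord by (rule F_coord)
    show "Poly_Mapping.lookup (F x) p \<ge> 0" for p
      using x_coord x_nonneg by (cases p) (simp add: lookup_F, metis coord_space_iff order_refl)
    fix i assume i: "i \<in> {1..L}"
    then have "(\<Sum>k\<in>{1..d i + 1}. Poly_Mapping.lookup (F x) (i, k)) = (\<Sum>j | (i, j) \<in> E. Poly_Mapping.lookup x (i, j))"
      unfolding sum_out_left[OF i] by (intro sum.cong) (auto simp: lookup_F)
    \<comment> \<open>Left vertices have no incoming edge, so the total outflow is the
      netflow.\<close>
    also have "\<dots> = real_of_int (netflow a i)"
      using cons[of i] i d_le[OF i] by (simp add: edge_into_left)
    finally show "(\<Sum>k\<in>{1..d i + 1}. Poly_Mapping.lookup (F x) (i, k)) = real_of_int (netflow a i)" .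
  qed
  moreover have "x = M (F x) + base_flow"
  proof (rule poly_mapping_eqI)
    fix e
    show "Poly_Mapping.lookup x e = Poly_Mapping.lookup (M (F x) + base_flow) e"
    proof (cases "e \<in> E")
      case True
      then show ?thesis
      proof (cases rule: edge_cases)
        case (left i j)
        then show ?thesis
          by (auto simp: lookup_add lookup_M_left lookup_base_flow lookup_F)
      next
        case (right j)
        have "(\<Sum>r | (r, j) \<in> E. Poly_Mapping.lookup (F x) (r, m + 2 - j)) = (\<Sum>r | (r, j) \<in> E. Poly_Mapping.lookup x (r, j))"
          using right by (intro sum.cong) (auto simp: lookup_F edge_into_right_iff)
        then show ?thesis
          using right(2) cons[of j] lookup_M_right[OF right(2), of "F x"]
          by (simp add: right(1) lookup_add lookup_base_flow edge_from_right_iff)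
      qed
    next
      case False
      then show ?thesis
        using x_coord M_coord c_lattice by (cases e) (simp add: lookup_add lattice_points_iff coord_space_iff)
    qed
  qed
  ultimately show "x \<in> (\<lambda>y. M y + base_flow) ` simplex_product {1..L} d (\<lambda>i. real_of_int (netflow a i))"
    by blast
next
  fix x assume "x \<in> (\<lambda>y. M y + base_flow) ` simplex_product {1..L} d (\<lambda>i. real_of_int (netflow a i))"
  then obtain y where x: "x = M y + base_flow"
    and y_nonneg: "\<And>p. Poly_Mapping.lookup y p \<ge> 0"
    and y_sum: "\<And>i. i \<in> {1..L} \<Longrightarrow> (\<Sum>k\<in>{1..d i + 1}. Poly_Mapping.lookup y (i, k)) = real_of_int (netflow a i)"
    by (auto simp: simplex_product_def simp del: sum.cl_ivl_Suc)
  have lookup_left: "Poly_Mapping.lookup x (i, j) = Poly_Mapping.lookup y (i, m + 2 - j)"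
    if "i \<in> {1..L}" "m + 1 - d i \<le> j" "j \<le> m + 1" for i j
    using that by (auto simp: x lookup_add lookup_M_left lookup_base_flow)
  have lookup_right: "Poly_Mapping.lookup x (j, m + 1)
      = (\<Sum>r | (r, j) \<in> E. Poly_Mapping.lookup y (r, m + 2 - j)) + real_of_int (netflow a j)"
    if "j \<in> {L+1..m}" for j
    using that lookup_M_right[OF that] by (simp add: x lookup_add lookup_base_flow)
  show "x \<in> flow_polytope E a"
  proof (rule flow_polytopeI[OF E_subset])
    show "x \<in> coord_space E"
      using M_coord c_lattice unfolding x
      by (intro subspace_add subspace_coord_space) (auto simp: lattice_points_iff)
    show "Poly_Mapping.lookup x e \<ge> 0" if "e \<in> E" for e
      using that
    proof (cases rule: edge_cases)
      case (left i j)
      then show ?thesis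
        using lookup_left y_nonneg by simp
    next
      case (right j)
      then show ?thesis
        \<comment> \<open>Positive netflow at the right vertices keeps the determined edges
          nonnegative.\<close>
        using lookup_right[OF right(2)] y_nonneg netflow_pos[of j]
        by (simp add: right(1) sum_nonneg)
    qed
    fix i assume "i \<in> {1..length a}"
    then consider "i \<in> {1..L}" | "i \<in> {L+1..m}"
      by (force simp: length_a)
    then show "(\<Sum>g | (g, i) \<in> E. Poly_Mapping.lookup x (g, i)) + real_of_int (netflow a i)
        = (\<Sum>j | (i, j) \<in> E. Poly_Mapping.lookup x (i, j))"
    proof cases
      case 1
      have "(\<Sum>j | (i, j) \<in> E. Poly_Mapping.lookup x (i, j)) = (\<Sum>k\<in>{1..d i + 1}. Poly_Mapping.lookup y (i, k))"
        unfolding sum_out_left[OF 1] using d_le_m[OF 1] 1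
        by (intro sum.cong) (auto simp: lookup_left)
      then show ?thesis
        using y_sum[OF 1] by (simp add: edge_into_left[OF 1])
    next
      case 2
      have "(\<Sum>g | (g, i) \<in> E. Poly_Mapping.lookup x (g, i)) = (\<Sum>r | (r, i) \<in> E. Poly_Mapping.lookup y (r, m + 2 - i))"
        using 2 by (intro sum.cong) (auto simp: lookup_left edge_into_right_iff)
      then show ?thesis
        using lookup_right[OF 2] by (simp add: edge_from_right_iff[OF 2])
    qed
  qed
qed

end

theorem theorem3p3:
  fixes lam :: "nat list" and n :: nat and a :: "int list"
  assumes "is_partition lam"
    and "n \<ge> nth_part lam 1 + length lam"
    and "length a = n"
    and "\<forall>x\<in>set a. x > 0"
  shows "integrally_equivalent
           (limiting_graph lam) (limiting_polytope lam a)
           (SIGMA i:{1..length lam}. {1..nth_part lam i + 1})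
           (product_polytope {1..length lam}
              (\<lambda>i. (\<lambda>x. real_of_int (a ! (i - 1)) *\<^sub>R x) ` std_simplex (nth_part lam i)))
       \<and> normalized_volume (limiting_graph lam) (limiting_polytope lam a)
         = fact (\<Sum>i=1..length lam. nth_part lam i)
           * (\<Prod>i=1..length lam. real_of_int (a ! (i - 1)) ^ nth_part lam i / fact (nth_part lam i))"
proof -
  define L where "L = length lam"
  define m where "m = L + nth_part lam 1"
  \<comment> \<open>Lattice points are counted for natural scale factors, so the positive integer
    entries are converted.\<close>
  define N where "N i = nat (a ! (i - 1))" for i
  \<comment> \<open>With \<open>m = L + nth_part lam 1\<close>, sortedness of the partition supplies
    the bound \<open>d_le\<close>.\<close>
  have le_first: "nth_part lam i \<le> nth_part lam 1" if "i \<in> {1..L}" for i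
  proof (cases "i = 1")
    case False
    then show ?thesis
      using assms(1) that sorted_wrt_nth_less[of "(\<ge>)" lam 0 "i - 1"]
      by (auto simp: is_partition_def nth_part_def L_def)
  qed simp
  interpret bipartite_flow L m "nth_part lam" "take m a"
    using assms le_first by unfold_locales (auto simp: m_def L_def dest: in_set_takeD)
  have m: "m \<le> length a" "L \<le> m"
    using assms by (auto simp: m_def L_def)
  have N: "real_of_int (a ! (i - 1)) = real (N i)" "N i > 0" if "i \<in> {1..L}" for i
  proof -
    have "a ! (i - 1) > 0"
      using m that by (intro assms(4)[rule_format] nth_mem) auto
    then show "real_of_int (a ! (i - 1)) = real (N i)" "N i > 0"
      by (simp_all add: N_def)
  qed
  \<comment> \<open>The index is at most \<open>m\<close>, so truncation leaves the entry intact and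
    it is not the closing entry for the sink.\<close>
  have "netflow (take m a) i = a ! (i - 1)" if "i \<in> {1..L}" for i
  proof -
    have "i - 1 < m"
      using m that by auto
    then show ?thesis
      using m that by (simp add: netflow_def)
  qed
  then have "simplex_product {1..L} (nth_part lam) (\<lambda>i. real_of_int (netflow (take m a) i))
      = simplex_product {1..L} (nth_part lam) (\<lambda>i. real (N i))"
    using N by (auto simp: simplex_product_def simp del: sum.cl_ivl_Suc)
  moreover have graph: "limiting_graph lam = E"
    unfolding E_def limiting_graph_def partition_graph_def by (simp add: m_def L_def)
  ultimately have limit: "limiting_polytope lam a
      = (\<lambda>y. M y + base_flow) ` simplex_product {1..L} (nth_part lam) (\<lambda>i. real (N i))"
    using flow_polytope_eq by (simp add: limiting_polytope_def m_def L_def)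
  have "product_polytope {1..L} (\<lambda>i. (\<lambda>x. real_of_int (a ! (i - 1)) *\<^sub>R x) ` std_simplex (nth_part lam i))
      = simplex_product {1..L} (nth_part lam) (\<lambda>i. real (N i))"
    using N product_polytope_scaled_simplices[of "{1..L}" "\<lambda>i. real_of_int (a ! (i - 1))" "nth_part lam"]
    by (auto simp: simplex_product_def simp del: sum.cl_ivl_Suc)
  moreover have "integer_polytope B (simplex_product {1..L} (nth_part lam) (\<lambda>i. real (N i)))"
    using N by (intro integer_polytope_simplex_product) auto
  moreover have "normalized_volume B (simplex_product {1..L} (nth_part lam) (\<lambda>i. real (N i)))
      = fact (\<Sum>i=1..L. nth_part lam i)
        * (\<Prod>i=1..L. real_of_int (a ! (i - 1)) ^ nth_part lam i / fact (nth_part lam i))"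
    using N by (subst normalized_volume_simplex_product) (auto intro!: prod.cong)
  ultimately show ?thesis
    using integrally_equivalent_section normalized_volume_section[OF simplex_product_coord]
    unfolding graph limit L_def by simp
qed

end
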